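(* Let $A\in\mathbb{R}^{n\times n}$, let $\Delta\in\mathbb{R}^{n\times n}$ be entrywise nonnegative, let $e=(1,\dots,1)^T\in\mathbb{R}^n$, and let $\alpha$ be maximal and $\beta$ minimal such that $\alpha ee^T\le\Delta\le\beta ee^T$ entrywise. Then $$\frac{1}{\beta}\,r(A,ee^T)\le r(A,\Delta)\le\frac{1}{\alpha}\,r(A,ee^T).$$
   Context: For $A\in\mathbb{R}^{n\times n}$ and an entrywise nonnegative $\Delta\in\mathbb{R}^{n\times n}$, the regularity radius is $r(A,\Delta)=\min\{\delta\ge 0 : [A-\delta\Delta,A+\delta\Delta]\text{ is singular}\}$, with $r(A,\Delta)=\infty$ if no such $\delta$ exists. Here $[A-\delta\Delta,A+\delta\Delta]$ is the set of all real matrices $A'$ with $A-\delta\Delta\le A'\le A+\delta\Delta$ entrywise, and this set is called singular if it contains at least one singular matrix. If $\alpha=0$ or $\beta=0$, the quotient $\frac{1}{0}\,c$ is read as $+\infty$ for $c>0$ and as $0$ for $c=0$. *)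

theory Defs
  imports "HOL-Analysis.Analysis"
begin

definition ones_vec :: "real ^ 'n" where
  "ones_vec = (\<chi> i. 1)"

definition ones_mat :: "real ^ 'n ^ 'n" where
  "ones_mat = (columnvector ones_vec :: real ^ 1 ^ 'n) ** (rowvector ones_vec :: real ^ 'n ^ 1)"

lemma ones_mat_nth: "ones_mat $ i $ j = 1"
  by (simp add: ones_mat_def ones_vec_def columnvector_def rowvector_def matrix_matrix_mult_def)

text \<open>The library order on \<^typ>\<open>real ^ 'n ^ 'n\<close> is entrywise, so the library interval
  \<open>{L..U}\<close> is the interval matrix \<open>[L, U]\<close>, and \<open>0 \<le> \<Delta>\<close> is entrywise nonnegativity.\<close>

definition singular_matrices :: "(real ^ 'n ^ 'n) set \<Rightarrow> bool" where
  "singular_matrices M \<longleftrightarrow> (\<exists>A'\<in>M. \<not> invertible A')"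

definition radius_candidate :: "real ^ 'n ^ 'n \<Rightarrow> real ^ 'n ^ 'n \<Rightarrow> real \<Rightarrow> bool" where
  "radius_candidate A \<Delta> \<delta> \<longleftrightarrow>
     0 \<le> \<delta> \<and> singular_matrices {A - \<delta> *\<^sub>R \<Delta> .. A + \<delta> *\<^sub>R \<Delta>}"

definition regularity_radius :: "real ^ 'n ^ 'n \<Rightarrow> real ^ 'n ^ 'n \<Rightarrow> ereal" where
  "regularity_radius A \<Delta> =
     (if \<exists>\<delta>. radius_candidate A \<Delta> \<delta> then ereal (LEAST \<delta>. radius_candidate A \<Delta> \<delta>) else \<infinity>)"

text \<open>For \<open>0 \<le> \<Delta>\<close> the minimum in the definition is attained, so the \<open>LEAST\<close> is meaningful.\<close>

lemma regularity_radius_attained: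
  fixes A \<Delta> :: "real ^ 'n ^ 'n"
  assumes nn: "0 \<le> \<Delta>" and ex: "radius_candidate A \<Delta> \<delta>\<^sub>0"
  shows "radius_candidate A \<Delta> (LEAST \<delta>. radius_candidate A \<Delta> \<delta>)"
    and "radius_candidate A \<Delta> \<delta> \<Longrightarrow> (LEAST \<delta>. radius_candidate A \<Delta> \<delta>) \<le> \<delta>"
proof -
  define K where "K = {p :: (real ^ 'n ^ 'n) \<times> real.
    0 \<le> snd p \<and> snd p \<le> \<delta>\<^sub>0 \<and> A - snd p *\<^sub>R \<Delta> \<le> fst p \<and> fst p \<le> A + snd p *\<^sub>R \<Delta> \<and> det (fst p) = 0}"
  have K_iff: "(\<exists>B. (B, d) \<in> K) \<longleftrightarrow> radius_candidate A \<Delta> d \<and> d \<le> \<delta>\<^sub>0" for d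
    by (auto simp: K_def radius_candidate_def singular_matrices_def invertible_det_nz)
  have "closed K"
    unfolding K_def less_eq_vec_def det_def
    by (intro closed_Collect_conj closed_Collect_le closed_Collect_eq closed_Collect_all
        continuous_intros)
  moreover have "K \<subseteq> {A - \<delta>\<^sub>0 *\<^sub>R \<Delta> .. A + \<delta>\<^sub>0 *\<^sub>R \<Delta>} \<times> {0..\<delta>\<^sub>0}"
  proof
    fix p assume p: "p \<in> K"
    have "snd p *\<^sub>R \<Delta> \<le> \<delta>\<^sub>0 *\<^sub>R \<Delta>"
      using p nn by (intro scaleR_right_mono) (auto simp: K_def)
    then have "A - \<delta>\<^sub>0 *\<^sub>R \<Delta> \<le> A - snd p *\<^sub>R \<Delta>" "A + snd p *\<^sub>R \<Delta> \<le> A + \<delta>\<^sub>0 *\<^sub>R \<Delta>"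
      by (auto intro: diff_left_mono add_left_mono)
    moreover have "A - snd p *\<^sub>R \<Delta> \<le> fst p" "fst p \<le> A + snd p *\<^sub>R \<Delta>" "snd p \<in> {0..\<delta>\<^sub>0}"
      using p by (simp_all add: K_def)
    ultimately have "A - \<delta>\<^sub>0 *\<^sub>R \<Delta> \<le> fst p" "fst p \<le> A + \<delta>\<^sub>0 *\<^sub>R \<Delta>" "snd p \<in> {0..\<delta>\<^sub>0}"
      by (blast intro: order.trans)+
    then show "p \<in> {A - \<delta>\<^sub>0 *\<^sub>R \<Delta> .. A + \<delta>\<^sub>0 *\<^sub>R \<Delta>} \<times> {0..\<delta>\<^sub>0}"
      by (simp add: mem_Times_iff)
  qed
  ultimately have "compact K"
    by (metis compact_Int_closed compact_Times compact_interval inf.absorb2)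
  moreover have "K \<noteq> {}"
    using K_iff[of \<delta>\<^sub>0] ex by auto
  ultimately obtain p where p: "p \<in> K" and min: "\<And>q. q \<in> K \<Longrightarrow> snd p \<le> snd q"
    using continuous_attains_inf[of K snd] continuous_on_snd[OF continuous_on_id, of K] by auto
  have cand: "radius_candidate A \<Delta> (snd p)" and le: "snd p \<le> \<delta>\<^sub>0"
    using K_iff[of "snd p"] p by (metis prod.collapse)+
  have least: "snd p \<le> d" if "radius_candidate A \<Delta> d" for d
  proof (cases "d \<le> \<delta>\<^sub>0")
    case True
    with K_iff[of d] that obtain B where "(B, d) \<in> K" by blast
    from min[OF this] show ?thesis by simp
  qed (use le in simp)
  have "(LEAST \<delta>. radius_candidate A \<Delta> \<delta>) = snd p"
    using cand least by (rule Least_equality)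
  with cand least show "radius_candidate A \<Delta> (LEAST \<delta>. radius_candidate A \<Delta> \<delta>)"
    and "radius_candidate A \<Delta> \<delta> \<Longrightarrow> (LEAST \<delta>. radius_candidate A \<Delta> \<delta>) \<le> \<delta>"
    by simp_all
qed

text \<open>Division in \<^typ>\<open>ereal\<close> agrees with the convention for the quotient with denominator zero.\<close>

lemma ereal_one_divide_zero_times:
  fixes c :: ereal
  shows "0 < c \<Longrightarrow> 1 / 0 * c = \<infinity>" and "1 / (0 :: ereal) * 0 = 0"
  by (simp_all add: divide_ereal_def)

end

theory Submission
  imports Defs
begin

text \<open>If \<open>D \<le> c E\<close>, then \<open>[A - \<delta> D, A + \<delta> D]\<close> lies in \<open>[A - \<delta> c E, A + \<delta> c E]\<close>, so a
  singular matrix in the former lies in the latter and \<open>r(A, E) \<le> c r(A, D)\<close>. This applies to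
  \<open>\<Delta> \<le> \<beta> e e\<^sup>T\<close> and to \<open>e e\<^sup>T \<le> \<alpha>\<inverse> \<Delta>\<close>. When \<open>\<alpha>\<close> or \<open>\<beta>\<close> is zero, what matters is that the radius
  vanishes exactly when \<open>A\<close> itself is singular.\<close>

lemma radius_candidate_scale:
  assumes "D \<le> c *\<^sub>R E" "0 \<le> c" "radius_candidate A D \<delta>"
  shows "radius_candidate A E (c * \<delta>)"
proof -
  have "0 \<le> \<delta>" and sing: "singular_matrices {A - \<delta> *\<^sub>R D .. A + \<delta> *\<^sub>R D}"
    using assms(3) by (auto simp: radius_candidate_def)
  have "\<delta> *\<^sub>R D \<le> \<delta> *\<^sub>R (c *\<^sub>R E)"
    using assms(1) \<open>0 \<le> \<delta>\<close> by (rule scaleR_left_mono)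
  then have le: "\<delta> *\<^sub>R D \<le> (c * \<delta>) *\<^sub>R E"
    by (simp add: mult.commute)
  have "{A - \<delta> *\<^sub>R D .. A + \<delta> *\<^sub>R D} \<subseteq> {A - (c * \<delta>) *\<^sub>R E .. A + (c * \<delta>) *\<^sub>R E}"
    using diff_left_mono[OF le, of A] add_left_mono[OF le, of A]
    by (simp add: atLeastatMost_subset_iff)
  with sing \<open>0 \<le> \<delta>\<close> \<open>0 \<le> c\<close> show ?thesis
    unfolding radius_candidate_def singular_matrices_def by (blast intro: mult_nonneg_nonneg)
qed

text \<open>At \<delta> = 0 the interval matrix collapses to the single matrix A.\<close>

lemma radius_candidate_zero_iff: "radius_candidate A D 0 \<longleftrightarrow> \<not> invertible A"
  by (simp add: radius_candidate_def singular_matrices_def)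

lemma regularity_radius_le:
  assumes "0 \<le> D" "radius_candidate A D \<delta>"
  shows "regularity_radius A D \<le> ereal \<delta>"
  using regularity_radius_attained(2)[OF assms assms(2)] assms(2)
  by (auto simp: regularity_radius_def)

lemma regularity_radius_cases:
  assumes "0 \<le> D"
  obtains "regularity_radius A D = \<infinity>"
  | \<delta> where "regularity_radius A D = ereal \<delta>" "radius_candidate A D \<delta>"
  using regularity_radius_attained(1)[OF assms] unfolding regularity_radius_def by metis

lemma regularity_radius_nonneg:
  assumes "0 \<le> D"
  shows "0 \<le> regularity_radius A D"
  by (rule regularity_radius_cases[OF assms, of A]) (auto simp: radius_candidate_def)

text \<open>Since the minimum is attained, a zero radius makes 0 itself a candidate, and its
  interval contains A alone. Conversely, the candidate 0 bounds the radius from above.\<close>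

lemma regularity_radius_eq_0_iff:
  assumes "0 \<le> D"
  shows "regularity_radius A D = 0 \<longleftrightarrow> \<not> invertible A"
proof
  assume "regularity_radius A D = 0"
  then show "\<not> invertible A"
    by (cases rule: regularity_radius_cases[OF assms, of A])
      (auto simp: radius_candidate_zero_iff zero_ereal_def)
next
  assume "\<not> invertible A"
  then have "regularity_radius A D \<le> 0"
    using regularity_radius_le[OF assms, of A 0] by (simp add: radius_candidate_zero_iff zero_ereal_def)
  with regularity_radius_nonneg[OF assms] show "regularity_radius A D = 0"
    by (simp add: order.antisym)
qed

lemma regularity_radius_zero_right:
  assumes "invertible A"
  shows "regularity_radius A 0 = \<infinity>"
  using assms by (simp add: regularity_radius_def radius_candidate_def singular_matrices_def)

text \<open>Scaling the least candidate for D by c gives a candidate for E. If D has no candidate,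
  \<open>0 < c\<close> makes the right-hand side \<infinity>; with c = 0 the \<open>ereal\<close>
  product would be 0.\<close>

lemma regularity_radius_le_scale:
  assumes "0 \<le> D" "0 \<le> E" "D \<le> c *\<^sub>R E" "0 < c"
  shows "regularity_radius A E \<le> ereal c * regularity_radius A D"
proof (cases rule: regularity_radius_cases[OF assms(1), of A])
  case 1
  with \<open>0 < c\<close> show ?thesis by simp
next
  case (2 \<delta>)
  then have "radius_candidate A E (c * \<delta>)"
    using assms by (intro radius_candidate_scale) auto
  with 2 show ?thesis
    using regularity_radius_le[OF assms(2)] by simp
qed

text \<open>Division by 0 in \<open>ereal\<close> is multiplication by \<infinity>, so only whether
  the radius is zero or positive matters, and invertibility of A decides this.\<close>

lemma regularity_radius_divide_zero:
  assumes "0 \<le> D"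
  shows "regularity_radius A D / 0 = (if invertible A then \<infinity> else 0)"
  using assms regularity_radius_nonneg[of D A] regularity_radius_eq_0_iff[of D A]
  by (auto simp: divide_ereal_def)

theorem mainTheorem11:
  fixes A \<Delta> :: "real ^ 'n ^ 'n" and \<alpha> \<beta> :: real
  assumes "0 \<le> \<Delta>"
    and "\<alpha> *\<^sub>R ones_mat \<le> \<Delta>" and "\<And>\<alpha>'. \<alpha>' *\<^sub>R ones_mat \<le> \<Delta> \<Longrightarrow> \<alpha>' \<le> \<alpha>"
    and "\<Delta> \<le> \<beta> *\<^sub>R ones_mat" and "\<And>\<beta>'. \<Delta> \<le> \<beta>' *\<^sub>R ones_mat \<Longrightarrow> \<beta> \<le> \<beta>'"
  shows "1 / ereal \<beta> * regularity_radius A ones_mat \<le> regularity_radius A \<Delta>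
    \<and> regularity_radius A \<Delta> \<le> 1 / ereal \<alpha> * regularity_radius A ones_mat"
proof
  have ones: "0 \<le> (ones_mat :: real ^ 'n ^ 'n)"
    by (simp add: less_eq_vec_def ones_mat_nth)
  \<comment> \<open>Maximality of \<alpha> is tested against the lower bound 0.\<close>
  have "0 \<le> \<alpha>"
    using assms(1) by (intro assms(3)) simp
  have "0 \<le> \<beta> *\<^sub>R (ones_mat :: real ^ 'n ^ 'n)"
    using assms(1,4) by (rule order.trans)
  then have "0 \<le> \<beta>"
    by (simp add: less_eq_vec_def ones_mat_nth)
  show "1 / ereal \<beta> * regularity_radius A ones_mat \<le> regularity_radius A \<Delta>"
  proof (cases "\<beta> = 0")
    case True
    with assms(1,4) have "\<Delta> = 0"
      by (simp add: order.antisym)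
    \<comment> \<open>For invertible A the radius for \<Delta> = 0 is \<infinity>; for singular A
      the quotient is 0 and nonnegativity suffices.\<close>
    with True show ?thesis
      by (simp add: regularity_radius_divide_zero[OF ones] regularity_radius_zero_right
          regularity_radius_nonneg flip: zero_ereal_def)
  next
    case False
    with \<open>0 \<le> \<beta>\<close> have "0 < \<beta>" by simp
    have "regularity_radius A ones_mat \<le> ereal \<beta> * regularity_radius A \<Delta>"
      using assms(1,4) ones \<open>0 < \<beta>\<close> by (intro regularity_radius_le_scale)
    with \<open>0 < \<beta>\<close> have "regularity_radius A ones_mat / ereal \<beta> \<le> regularity_radius A \<Delta>"
      by (simp add: ereal_divide_le_pos)
    then show ?thesis
      by (simp add: divide_ereal_def mult.commute)
  qed
  show "regularity_radius A \<Delta> \<le> 1 / ereal \<alpha> * regularity_radius A ones_mat"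
  proof (cases "\<alpha> = 0")
    case True
    \<comment> \<open>For invertible A the right-hand side is \<infinity>; for singular A both sides
      are 0.\<close>
    then show ?thesis
      using regularity_radius_eq_0_iff[OF assms(1), of A]
      by (auto simp: regularity_radius_divide_zero[OF ones] simp flip: zero_ereal_def)
  next
    case False
    with \<open>0 \<le> \<alpha>\<close> have "0 < \<alpha>" by simp
    \<comment> \<open>Dividing by \<alpha> puts \<open>ones_mat\<close> on the smaller side, so the
      scaling lemma applies with the two matrices in exchanged roles.\<close>
    have "inverse \<alpha> *\<^sub>R (\<alpha> *\<^sub>R ones_mat) \<le> inverse \<alpha> *\<^sub>R \<Delta>"
      using assms(2) \<open>0 < \<alpha>\<close> by (intro scaleR_left_mono) simp_all
    then have "ones_mat \<le> inverse \<alpha> *\<^sub>R \<Delta>"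
      using \<open>0 < \<alpha>\<close> by simp
    then have "regularity_radius A \<Delta> \<le> ereal (inverse \<alpha>) * regularity_radius A ones_mat"
      using assms(1) ones \<open>0 < \<alpha>\<close> by (intro regularity_radius_le_scale) auto
    with \<open>0 < \<alpha>\<close> show ?thesis
      by (simp add: divide_ereal_def)
  qed
qed

end
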